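(* Let $1\le k\le n$ and let $A\in\mathbb{R}^{2n\times 2k}$. Assume that all leading minors of even dimension of $P_{2k}A^TJ_{2n}AP_{2k}^T$ are nonzero, i.e., $\det\big((P_{2k}A^TJ_{2n}AP_{2k}^T)_{1:2j,1:2j}\big)\neq0$ for $j=1,\dots,k$. Then the symplectic Gram--Schmidt algorithm applied to $A$ produces a unique SR decomposition $A=SR$ with $S\in\mathrm{Sp}(2k,2n)$ and $R\in T_{2k}^0(P_{2k})$; that is, the algorithm runs to completion, its output $(S,R)$ satisfies $A=SR$, $S\in\mathrm{Sp}(2k,2n)$, $R\in T_{2k}^0(P_{2k})$, and it is the only pair with these properties.
   Context: For $m\ge 1$, $J_{2m}=\begin{bmatrix}0&I_m\\-I_m&0\end{bmatrix}$. $\mathrm{Sp}(2k,2n)=\{X\in\mathbb{R}^{2n\times 2k} : X^TJ_{2n}X=J_{2k}\}$. $P_{2k}=[e_1,e_3,\ldots,e_{2k-1},e_2,e_4,\ldots,e_{2k}]\in\mathbb{R}^{2k\times 2k}$, where $e_j$ is the $j$-th canonical basis vector of $\mathbb{R}^{2k}$. $T_{2k}^0(P_{2k})$ is the set of all matrices $P_{2k}^T\hat R P_{2k}$ where $\hat R=[r_{ij}]\in\mathbb{R}^{2k\times 2k}$ is upper triangular with $r_{2j-1,2j}=0$, $r_{2j-1,2j-1}>0$ and $|r_{2j,2j}|=r_{2j-1,2j-1}$ for $j=1,\ldots,k$. $(M)_{1:2j,1:2j}$ denotes the $2j\times2j$ leading principal submatrix of $M$. DESR algorithm (input $[a_1,a_2]\in\mathbb{R}^{2n\times2}$):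 compute $\omega=a_1^TJ_{2n}a_2$; if $\omega=0$, stop with an error (breakdown); otherwise set $r_{11}=\sqrt{|\omega|}$, $r_{22}=\mathrm{sign}(\omega)r_{11}$, $s_1=a_1/r_{11}$, $s_2=a_2/r_{22}$, and return $[s_1,s_2]$ and $\mathrm{diag}(r_{11},r_{22})$. Basic symplectic Gram--Schmidt algorithm (input $B=[B_1,\ldots,B_k]\in\mathbb{R}^{2n\times 2k}$ with $B_j\in\mathbb{R}^{2n\times 2}$): apply the DESR algorithm to $B_1$ to get $\hat S_1,\hat R_{11}$; for $j=2,\ldots,k$: compute $\hat R_{ij}=J_2^T\hat S_i^TJ_{2n}B_j$ for $i=1,\ldots,j-1$, compute $W_j=B_j-\sum_{i=1}^{j-1}\hat S_i\hat R_{ij}$, and apply the DESR algorithm to $W_j$ to get $\hat S_j,\hat R_{jj}$. Return $\hat S=[\hat S_1,\ldots,\hat S_k]$ and the block upper triangular matrix $\hat R$ with $2\times2$ blocks $\hat R_{ij}$, $1\le i\le j\le k$. Symplectic Gram--Schmidt algorithm (input $A\in\mathbb{R}^{2n\times 2k}$): apply the basic symplectic Gram--Schmidt algorithm to $AP_{2k}^T$ to get $\hat S,\hat R$; return $S=\hat SP_{2k}$ and $R=P_{2k}^T\hat RP_{2k}$. *)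

theory Defs
  imports
    "Jordan_Normal_Form.Matrix"
    "Jordan_Normal_Form.Determinant"
    "Jordan_Normal_Form.DL_Submatrix"
    "HOL-Library.Monad_Syntax"
    Complex_Main
begin

text \<open>
  Dimensions are passed as half-sizes: \<open>J_mat m\<close> is \<open>J\<^bsub>2m\<^esub>\<close>, \<open>P_mat k\<close> is \<open>P\<^bsub>2k\<^esub>\<close>,
  \<open>Sp k n\<close> is \<open>Sp(2k,2n)\<close>.  All indices, including those of 2-column blocks, start at 0, so
  the 1-based positions \<open>2j-1, 2j\<close> become \<open>2 * j, 2 * j + 1\<close>.
\<close>

definition J_mat :: "nat \<Rightarrow> real mat" where
  "J_mat m = four_block_mat (0\<^sub>m m m) (1\<^sub>m m) (- 1\<^sub>m m) (0\<^sub>m m m)"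

definition Sp :: "nat \<Rightarrow> nat \<Rightarrow> real mat set" where
  "Sp k n = {X \<in> carrier_mat (2 * n) (2 * k). X\<^sup>T * J_mat n * X = J_mat k}"

definition P_mat :: "nat \<Rightarrow> real mat" where
  "P_mat k = mat_of_cols (2 * k)
     (map (\<lambda>j. unit_vec (2 * k) (2 * j)) [0..<k] @
      map (\<lambda>j. unit_vec (2 * k) (2 * j + 1)) [0..<k])"

definition T0 :: "nat \<Rightarrow> real mat set" where
  "T0 k = {(P_mat k)\<^sup>T * R * P_mat k | R.
     R \<in> carrier_mat (2 * k) (2 * k) \<and> upper_triangular R \<and>
     (\<forall>j<k. R $$ (2 * j, 2 * j + 1) = 0 \<and> R $$ (2 * j, 2 * j) > 0 \<and>
            \<bar>R $$ (2 * j + 1, 2 * j + 1)\<bar> = R $$ (2 * j, 2 * j))}"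

definition leading_principal :: "'a mat \<Rightarrow> nat \<Rightarrow> 'a mat" where
  "leading_principal M m = submatrix M {..<m} {..<m}"

text \<open>In the algorithms below, \<open>None\<close> signals breakdown.\<close>

definition desr :: "nat \<Rightarrow> real mat \<Rightarrow> (real mat \<times> real mat) option" where
  "desr n W =
    (let a1 = col W 0; a2 = col W 1;
         \<omega> = a1 \<bullet> (J_mat n *\<^sub>v a2)
     in if \<omega> = 0 then None
        else
         (let r11 = sqrt \<bar>\<omega>\<bar>; r22 = sgn \<omega> * r11;
              s1 = (1 / r11) \<cdot>\<^sub>v a1; s2 = (1 / r22) \<cdot>\<^sub>v a2
          in Some (mat_of_cols (2 * n) [s1, s2],
                   mat_diag 2 (\<lambda>i. if i = 0 then r11 else r22))))"

definition col_block :: "real mat \<Rightarrow> nat \<Rightarrow> real mat" where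
  "col_block B j = mat (dim_row B) 2 (\<lambda>(r, c). B $$ (r, 2 * j + c))"

text \<open>
  The state after the first \<open>j\<close> blocks: the list of the blocks of \<open>S\<close> computed so far, and the
  list of block columns of \<open>R\<close>, the \<open>i\<close>-th of which has \<open>i + 1\<close> blocks and ends with
  the diagonal one.  For the first block the sum is empty, so the step is DESR applied to
  \<open>col_block B 0\<close> itself.
\<close>

fun bsgs_blocks :: "nat \<Rightarrow> real mat \<Rightarrow> nat \<Rightarrow> (real mat list \<times> real mat list list) option" where
  "bsgs_blocks n B 0 = Some ([], [])"
| "bsgs_blocks n B (Suc j) = do {
     (Ss, Rcols) \<leftarrow> bsgs_blocks n B j;
     let Bj = col_block B j;
     let Rs = map (\<lambda>Si. (J_mat 1)\<^sup>T * Si\<^sup>T * J_mat n * Bj) Ss;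
     let W = Bj - foldr (+) (map2 (*) Ss Rs) (0\<^sub>m (2 * n) 2);
     (Sj, Rjj) \<leftarrow> desr n W;
     Some (Ss @ [Sj], Rcols @ [Rs @ [Rjj]])
   }"

definition basic_symplectic_gram_schmidt ::
    "nat \<Rightarrow> nat \<Rightarrow> real mat \<Rightarrow> (real mat \<times> real mat) option" where
  "basic_symplectic_gram_schmidt n k B = do {
     (Ss, Rcols) \<leftarrow> bsgs_blocks n B k;
     Some (mat (2 * n) (2 * k) (\<lambda>(r, c). (Ss ! (c div 2)) $$ (r, c mod 2)),
           mat (2 * k) (2 * k) (\<lambda>(r, c).
             if r div 2 \<le> c div 2
             then (Rcols ! (c div 2) ! (r div 2)) $$ (r mod 2, c mod 2) else 0))
   }"

definition symplectic_gram_schmidt ::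
    "nat \<Rightarrow> nat \<Rightarrow> real mat \<Rightarrow> (real mat \<times> real mat) option" where
  "symplectic_gram_schmidt n k A = do {
     (S, R) \<leftarrow> basic_symplectic_gram_schmidt n k (A * (P_mat k)\<^sup>T);
     Some (S * P_mat k, (P_mat k)\<^sup>T * R * P_mat k)
   }"

end

theory Submission
  imports Defs
begin

text \<open>
  The permutation \<open>P\<close> is removed at the outset. With \<open>B = A P\<^sup>T\<close>, a decomposition of \<open>A\<close> in the required form is the
  same as a factorization \<open>B = S R\<close> in which \<open>R\<close> is upper triangular with the prescribed diagonal
  blocks and \<open>S\<^sup>T J S = \<Omega>\<close>, where \<open>\<Omega> = P J P\<^sup>T = diag(J\<^sub>2, \<dots>, J\<^sub>2)\<close> (\<open>sr_decomposition_iff_sr_factor\<close>).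

  Existence and uniqueness then have separate reasons. For uniqueness, let \<open>B = S R\<close> be any such factorization.
  Its last two columns \<open>E\<close> satisfy \<open>E = S\<^sub>0 C + T D\<close>, where \<open>S = [S\<^sub>0, T]\<close> and \<open>C\<close>, \<open>D\<close> are the
  upper and the lower part of the last two columns of \<open>R\<close>. Since \<open>S\<^sub>0\<^sup>T J S\<^sub>0 = \<Omega>\<close>,
  \<open>S\<^sub>0\<^sup>T J T = 0\<close> and \<open>\<Omega>\<^sup>T \<Omega> = I\<close>, necessarily \<open>C = \<Omega>\<^sup>T S\<^sub>0\<^sup>T J E\<close>; and \<open>T D\<close> is a factorization of two columns,
  where the sign and size conditions on \<open>D\<close> leave only the choice that DESR makes
  (\<open>sr_factor_Suc_cases\<close>, \<open>desr_sr_factor\<close>). By induction the algorithm, run on \<open>B\<close>, returns exactly \<open>(S, R)\<close>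
  (\<open>basic_symplectic_gram_schmidt_sr_factor\<close>). As the algorithm is a function, there is at most one
  factorization, and if there is one, the algorithm runs to completion and finds it.

  It remains to see that a factorization exists (\<open>sr_factor_exists\<close>). This is where the minors enter. Given a
  factorization of the first \<open>2j\<close> columns and the next pair \<open>E\<close>, the remainder
  \<open>W = E - S C\<close> with \<open>C = \<Omega>\<^sup>T S\<^sup>T J E\<close> satisfies \<open>S\<^sup>T J W = 0\<close>. So the minor of order \<open>2 (j + 1)\<close> of \<open>B\<^sup>T J B\<close>
  is a multiple of \<open>det (W\<^sup>T J W) = \<omega>\<^sup>2\<close>, where \<open>\<omega>\<close> is the product of the two columns of \<open>W\<close>. It is nonzero, hence so
  is \<open>\<omega>\<close>, and the columns of \<open>W\<close> can be scaled to have product 1.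
\<close>

section \<open>The reordered problem\<close>

definition symp_prod :: "nat \<Rightarrow> real mat \<Rightarrow> real mat \<Rightarrow> real mat" where
  "symp_prod n X Y = X\<^sup>T * J_mat n * Y"

text \<open>
  Writing \<open>[X, Y]\<close> as a four-block matrix with an empty second row of blocks makes the block
  multiplication rule available for it.
\<close>

definition hcat :: "real mat \<Rightarrow> real mat \<Rightarrow> real mat" where
  "hcat X Y = four_block_mat X Y (0\<^sub>m 0 (dim_col X)) (0\<^sub>m 0 (dim_col Y))"

definition first_cols :: "real mat \<Rightarrow> nat \<Rightarrow> real mat" where
  "first_cols X m = mat (dim_row X) m (\<lambda>rc. X $$ rc)"

definition row_block :: "real mat \<Rightarrow> nat \<Rightarrow> real mat" where
  "row_block X i = mat 2 (dim_col X) (\<lambda>(r, c). X $$ (2 * i + r, c))"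

text \<open>
  The entries of \<open>diag(J\<^sub>2, \<dots>, J\<^sub>2)\<close>, which is \<open>P J\<^bsub>2k\<^esub> P\<^sup>T\<close>.
\<close>

definition block_J :: "nat \<Rightarrow> real mat" where
  "block_J k = mat (2 * k) (2 * k) (\<lambda>(r, c).
     if even r \<and> c = Suc r then 1 else if odd r \<and> r = Suc c then - 1 else 0)"

text \<open>
  The matrices from which \<^const>\<open>T0\<close> arises by conjugation with \<open>P\<close>.
\<close>

definition T0_hat :: "nat \<Rightarrow> real mat set" where
  "T0_hat k = {R \<in> carrier_mat (2 * k) (2 * k). upper_triangular R \<and>
     (\<forall>j<k. R $$ (2 * j, 2 * j + 1) = 0 \<and> R $$ (2 * j, 2 * j) > 0 \<and>
            \<bar>R $$ (2 * j + 1, 2 * j + 1)\<bar> = R $$ (2 * j, 2 * j))}"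

text \<open>
  An SR decomposition in the coordinates in which the algorithm works: for \<open>B = A P\<^sup>T\<close> the factor \<open>R\<close>
  is genuinely triangular, and \<open>J\<^bsub>2k\<^esub>\<close> becomes block diagonal.
\<close>

definition sr_factor :: "nat \<Rightarrow> nat \<Rightarrow> real mat \<Rightarrow> real mat \<Rightarrow> real mat \<Rightarrow> bool" where
  "sr_factor n k B S R \<longleftrightarrow>
     S \<in> carrier_mat (2 * n) (2 * k) \<and> symp_prod n S S = block_J k \<and> R \<in> T0_hat k \<and> B = S * R"

section \<open>Algebra of the matrix J and its block diagonal form\<close>

lemma J_mat_carrier [simp]: "J_mat n \<in> carrier_mat (2 * n) (2 * n)"
  by (rule carrier_matI) (simp_all add: J_mat_def)

lemma J_mat_dims [simp]: "dim_row (J_mat n) = 2 * n" "dim_col (J_mat n) = 2 * n"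
  by (simp_all add: J_mat_def)

lemma J_mat_index:
  assumes "r < 2 * k" "c < 2 * k"
  shows "J_mat k $$ (r, c) = (if c = r + k then 1 else if r = c + k then - 1 else 0)"
  using assms unfolding J_mat_def by auto

lemma J_mat_skew: "(J_mat n)\<^sup>T = - J_mat n"
  by (rule eq_matI) (auto simp: J_mat_index)

lemma block_J_carrier [simp]: "block_J k \<in> carrier_mat (2 * k) (2 * k)"
  unfolding block_J_def by auto

lemma block_J_dims [simp]: "dim_row (block_J k) = 2 * k" "dim_col (block_J k) = 2 * k"
  unfolding block_J_def by auto

lemma block_J_1: "block_J 1 = J_mat 1"
  by (rule eq_matI) (auto simp: block_J_def J_mat_index)

text \<open>
  This recursion is what lets \<open>S\<close> grow by two columns at a time.
\<close>

lemma block_J_Suc: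
  "block_J (Suc j) = four_block_mat (block_J j) (0\<^sub>m (2 * j) 2) (0\<^sub>m 2 (2 * j)) (block_J 1)"
  by (rule eq_matI) (auto simp: block_J_def split: if_splits; presburger)+

text \<open>
  Left multiplication by \<open>diag(J\<^sub>2\<^sup>T, \<dots>)\<close> swaps the rows within each pair, up to sign. Applied with
  \<open>k\<close> blocks and with one block, this compares the global coefficient matrix with the single
  blocks which the algorithm computes.
\<close>

lemma block_J_transpose_mult:
  assumes X: "X \<in> carrier_mat (2 * k) m" and i: "i < k" and c: "c < m"
  shows "((block_J k)\<^sup>T * X) $$ (2 * i, c) = - X $$ (2 * i + 1, c)"
    "((block_J k)\<^sup>T * X) $$ (2 * i + 1, c) = X $$ (2 * i, c)"
proof -
  have "((block_J k)\<^sup>T * X) $$ (2 * i, c) = (\<Sum>l = 0..<2 * k. block_J k $$ (l, 2 * i) * X $$ (l, c))"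
    using X i c by (auto simp: scalar_prod_def intro!: sum.cong)
  also have "\<dots> = (\<Sum>l = 0..<2 * k. if l = 2 * i + 1 then - X $$ (2 * i + 1, c) else 0)"
    using i by (intro sum.cong refl) (auto simp: block_J_def; metis dvd_triv_left even_Suc)
  finally show "((block_J k)\<^sup>T * X) $$ (2 * i, c) = - X $$ (2 * i + 1, c)"
    using i by simp
  have "((block_J k)\<^sup>T * X) $$ (2 * i + 1, c)
      = (\<Sum>l = 0..<2 * k. block_J k $$ (l, 2 * i + 1) * X $$ (l, c))"
    using X i c by (auto simp: scalar_prod_def intro!: sum.cong)
  also have "\<dots> = (\<Sum>l = 0..<2 * k. if l = 2 * i then X $$ (2 * i, c) else 0)"
    using i by (intro sum.cong) (auto simp: block_J_def)
  finally show "((block_J k)\<^sup>T * X) $$ (2 * i + 1, c) = X $$ (2 * i, c)"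
    using i by simp
qed

lemma nat_even_odd_cases:
  fixes r k :: nat
  assumes "r < 2 * k"
  obtains i where "i < k" "r = 2 * i" | i where "i < k" "r = 2 * i + 1"
proof -
  have "r = 2 * (r div 2) \<or> r = 2 * (r div 2) + 1" and "r div 2 < k" using assms by auto
  then show ?thesis using that by blast
qed

lemma block_J_orthogonal: "(block_J k)\<^sup>T * block_J k = 1\<^sub>m (2 * k)"
proof (rule eq_matI)
  fix r c assume "r < dim_row (1\<^sub>m (2 * k) :: real mat)" "c < dim_col (1\<^sub>m (2 * k) :: real mat)"
  then have r: "r < 2 * k" and c: "c < 2 * k" by auto
  from r show "((block_J k)\<^sup>T * block_J k) $$ (r, c) = 1\<^sub>m (2 * k) $$ (r, c)"
  proof (cases rule: nat_even_odd_cases)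
    case (1 i)
    then show ?thesis
      using block_J_transpose_mult(1)[OF block_J_carrier _ c] c r by (auto simp: block_J_def)
  next
    case (2 i)
    then show ?thesis
      using block_J_transpose_mult(2)[OF block_J_carrier _ c] c r by (auto simp: block_J_def)
  qed
qed auto

lemma block_J_orthogonal': "block_J k * (block_J k)\<^sup>T = 1\<^sub>m (2 * k)"
  by (rule mat_mult_left_right_inverse[OF _ _ block_J_orthogonal]) auto

lemma row_block_transpose_block_J:
  assumes X: "X \<in> carrier_mat (2 * k) m" and i: "i < k"
  shows "row_block ((block_J k)\<^sup>T * X) i = (block_J 1)\<^sup>T * row_block X i"
proof (rule eq_matI)
  fix r c assume "r < dim_row ((block_J 1)\<^sup>T * row_block X i)" "c < dim_col ((block_J 1)\<^sup>T * row_block X i)"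
  then have r: "r = 0 \<or> r = 1" and c: "c < m" using X by (auto simp: row_block_def)
  have Y: "row_block X i \<in> carrier_mat (2 * 1) m" using X by (auto simp: row_block_def)
  note L = block_J_transpose_mult[OF X i c] and R = block_J_transpose_mult[OF Y _ c, of 0]
  show "row_block ((block_J k)\<^sup>T * X) i $$ (r, c) = ((block_J 1)\<^sup>T * row_block X i) $$ (r, c)"
    using r L R X c by (auto simp: row_block_def simp del: index_mult_mat(1))
qed (use X in \<open>auto simp: row_block_def\<close>)

section \<open>The symplectic product of two matrices\<close>

lemma symp_prod_carrier [simp]:
  assumes "X \<in> carrier_mat (2 * n) a" "Y \<in> carrier_mat (2 * n) b"
  shows "symp_prod n X Y \<in> carrier_mat a b"
  using assms unfolding symp_prod_def by auto

lemma symp_prod_index: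
  assumes "X \<in> carrier_mat (2 * n) a" "Y \<in> carrier_mat (2 * n) b" "r < a" "s < b"
  shows "symp_prod n X Y $$ (r, s) = col X r \<bullet> (J_mat n *\<^sub>v col Y s)"
proof -
  have "symp_prod n X Y = X\<^sup>T * (J_mat n * Y)"
    unfolding symp_prod_def by (rule assoc_mult_mat[of _ a "2 * n" _ "2 * n" _ b]) (use assms in auto)
  also have "\<dots> $$ (r, s) = col X r \<bullet> col (J_mat n * Y) s" using assms by auto
  also have "col (J_mat n * Y) s = J_mat n *\<^sub>v col Y s"
    by (rule col_mult2[of _ "2 * n" "2 * n" _ b]) (use assms in auto)
  finally show ?thesis .
qed

lemma symp_prod_mult:
  assumes X: "X \<in> carrier_mat (2 * n) a" and Y: "Y \<in> carrier_mat (2 * n) b"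
    and M: "M \<in> carrier_mat a c" and N: "N \<in> carrier_mat b d"
  shows "symp_prod n (X * M) (Y * N) = M\<^sup>T * symp_prod n X Y * N"
proof -
  have "(X * M)\<^sup>T * J_mat n * (Y * N) = M\<^sup>T * X\<^sup>T * J_mat n * (Y * N)"
    using transpose_mult[OF X M] by simp
  also have "\<dots> = M\<^sup>T * X\<^sup>T * J_mat n * Y * N"
    by (rule assoc_mult_mat[symmetric, of _ c "2 * n" _ b _ d]) (use assms in auto)
  also have "M\<^sup>T * X\<^sup>T * J_mat n = M\<^sup>T * (X\<^sup>T * J_mat n)"
    by (rule assoc_mult_mat[of _ c a _ "2 * n" _ "2 * n"]) (use assms in auto)
  also have "M\<^sup>T * (X\<^sup>T * J_mat n) * Y = M\<^sup>T * (X\<^sup>T * J_mat n * Y)"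
    by (rule assoc_mult_mat[of _ c a _ "2 * n" _ b]) (use assms in auto)
  finally show ?thesis unfolding symp_prod_def .
qed

lemma symp_prod_mult_right:
  assumes X: "X \<in> carrier_mat (2 * n) a" and Y: "Y \<in> carrier_mat (2 * n) b" and N: "N \<in> carrier_mat b d"
  shows "symp_prod n X (Y * N) = symp_prod n X Y * N"
  using assms unfolding symp_prod_def
  by (intro assoc_mult_mat[symmetric, of _ a "2 * n" _ b _ d]) auto

lemma symp_prod_swap:
  assumes X: "X \<in> carrier_mat (2 * n) a" and Y: "Y \<in> carrier_mat (2 * n) b"
  shows "symp_prod n Y X = - (symp_prod n X Y)\<^sup>T"
proof -
  have "(symp_prod n X Y)\<^sup>T = Y\<^sup>T * (X\<^sup>T * J_mat n)\<^sup>T"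
    unfolding symp_prod_def by (rule transpose_mult) (use assms in auto)
  also have "(X\<^sup>T * J_mat n)\<^sup>T = - J_mat n * X"
    using transpose_mult[of "X\<^sup>T" a "2 * n" "J_mat n" "2 * n"] X by (simp add: J_mat_skew)
  also have "Y\<^sup>T * (- J_mat n * X) = Y\<^sup>T * - J_mat n * X"
    by (rule assoc_mult_mat[symmetric, of _ b "2 * n" _ "2 * n" _ a]) (use assms in auto)
  also have "\<dots> = - symp_prod n Y X"
    using assms unfolding symp_prod_def by simp
  finally show ?thesis using symp_prod_carrier[OF Y X] by simp
qed

lemma symp_prod_minus_right:
  assumes X: "X \<in> carrier_mat (2 * n) a" and Y: "Y \<in> carrier_mat (2 * n) b" and Z: "Z \<in> carrier_mat (2 * n) b"
  shows "symp_prod n X (Y - Z) = symp_prod n X Y - symp_prod n X Z"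
  unfolding symp_prod_def by (rule mult_minus_distrib_mat) (use assms in auto)

lemma symp_prod_add_right:
  assumes X: "X \<in> carrier_mat (2 * n) a" and Y: "Y \<in> carrier_mat (2 * n) b" and Z: "Z \<in> carrier_mat (2 * n) b"
  shows "symp_prod n X (Y + Z) = symp_prod n X Y + symp_prod n X Z"
  unfolding symp_prod_def by (rule mult_add_distrib_mat) (use assms in auto)

section \<open>Block rows\<close>

lemma hcat_carrier [simp]:
  "X \<in> carrier_mat m a \<Longrightarrow> Y \<in> carrier_mat m b \<Longrightarrow> hcat X Y \<in> carrier_mat m (a + b)"
  by (intro carrier_matI) (auto simp: hcat_def)

lemma four_block_mat_inject:
  assumes "A \<in> carrier_mat a b" "A' \<in> carrier_mat a b" "B \<in> carrier_mat a d" "B' \<in> carrier_mat a d"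
    "C \<in> carrier_mat c b" "C' \<in> carrier_mat c b" "D \<in> carrier_mat c d" "D' \<in> carrier_mat c d"
  shows "four_block_mat A B C D = four_block_mat A' B' C' D' \<longleftrightarrow> A = A' \<and> B = B' \<and> C = C' \<and> D = D'"
proof
  assume eq: "four_block_mat A B C D = four_block_mat A' B' C' D'"
  have *: "four_block_mat A B C D $$ (r, s) = four_block_mat A' B' C' D' $$ (r, s)" for r s
    using eq by simp
  have "A $$ (r, s) = A' $$ (r, s)" if "r < a" "s < b" for r s
    using *[of r s] that assms by auto
  moreover have "B $$ (r, s) = B' $$ (r, s)" if "r < a" "s < d" for r s
    using *[of r "b + s"] that assms by auto
  moreover have "C $$ (r, s) = C' $$ (r, s)" if "r < c" "s < b" for r s
    using *[of "a + r" s] that assms by auto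
  moreover have "D $$ (r, s) = D' $$ (r, s)" if "r < c" "s < d" for r s
    using *[of "a + r" "b + s"] that assms by auto
  ultimately show "A = A' \<and> B = B' \<and> C = C' \<and> D = D'"
    using assms by (auto intro!: eq_matI)
qed simp

lemma hcat_inject:
  assumes "X \<in> carrier_mat m a" "X' \<in> carrier_mat m a" "Y \<in> carrier_mat m b" "Y' \<in> carrier_mat m b"
  shows "hcat X Y = hcat X' Y' \<longleftrightarrow> X = X' \<and> Y = Y'"
proof -
  have d: "dim_col X = a" "dim_col X' = a" "dim_col Y = b" "dim_col Y' = b" using assms by auto
  show ?thesis unfolding hcat_def d
    using assms by (subst four_block_mat_inject[of _ m a _ _ b _ _ 0]) auto
qed

lemma hcat_cases:
  assumes "Z \<in> carrier_mat m (a + b)"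
  obtains X Y where "X \<in> carrier_mat m a" "Y \<in> carrier_mat m b" "Z = hcat X Y"
proof
  show "mat m a (\<lambda>rc. Z $$ rc) \<in> carrier_mat m a" "mat m b (\<lambda>(r, c). Z $$ (r, a + c)) \<in> carrier_mat m b"
    by auto
  show "Z = hcat (mat m a (\<lambda>rc. Z $$ rc)) (mat m b (\<lambda>(r, c). Z $$ (r, a + c)))"
    using assms by (intro eq_matI) (auto simp: hcat_def)
qed

lemma hcat_mult_upper:
  assumes "X \<in> carrier_mat m a" "Y \<in> carrier_mat m b" "R \<in> carrier_mat a c" "C \<in> carrier_mat a d" "D \<in> carrier_mat b d"
  shows "hcat X Y * four_block_mat R C (0\<^sub>m b c) D = hcat (X * R) (X * C + Y * D)"
proof -
  have dc: "dim_col X = a" "dim_col Y = b" "dim_col (X * R) = c" "dim_col (X * C + Y * D) = d"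
    using assms by auto
  have "hcat X Y * four_block_mat R C (0\<^sub>m b c) D =
    four_block_mat (X * R + Y * 0\<^sub>m b c) (X * C + Y * D)
     (0\<^sub>m 0 a * R + 0\<^sub>m 0 b * 0\<^sub>m b c) (0\<^sub>m 0 a * C + 0\<^sub>m 0 b * D)"
    unfolding hcat_def dc by (rule mult_four_block_mat) (use assms in auto)
  also have "X * R + Y * 0\<^sub>m b c = X * R" using assms by simp
  also have "0\<^sub>m 0 a * R + 0\<^sub>m 0 b * 0\<^sub>m b c = 0\<^sub>m 0 c" using assms by (intro eq_matI) auto
  also have "0\<^sub>m 0 a * C + 0\<^sub>m 0 b * D = 0\<^sub>m 0 d" using assms by (intro eq_matI) auto
  finally show ?thesis unfolding hcat_def dc .
qed

lemma symp_prod_hcat: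
  assumes X: "X \<in> carrier_mat (2 * n) a" and Y: "Y \<in> carrier_mat (2 * n) b"
    and U: "U \<in> carrier_mat (2 * n) c" and V: "V \<in> carrier_mat (2 * n) d"
  shows "symp_prod n (hcat X Y) (hcat U V) =
    four_block_mat (symp_prod n X U) (symp_prod n X V) (symp_prod n Y U) (symp_prod n Y V)"
proof (rule eq_matI)
  let ?F = "four_block_mat (symp_prod n X U) (symp_prod n X V) (symp_prod n Y U) (symp_prod n Y V)"
  note cs = symp_prod_carrier[OF X U] symp_prod_carrier[OF X V] symp_prod_carrier[OF Y U] symp_prod_carrier[OF Y V]
  have colh: "col (hcat P Q) s = (if s < p then col P s else col Q (s - p))"
    if "P \<in> carrier_mat (2 * n) p" "Q \<in> carrier_mat (2 * n) q" "s < p + q" for P Q p q s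
    using that by (auto simp: hcat_def)
  fix r s assume "r < dim_row ?F" "s < dim_col ?F"
  then have rs: "r < a + b" "s < c + d" using cs by auto
  show "symp_prod n (hcat X Y) (hcat U V) $$ (r, s) = ?F $$ (r, s)"
    using rs cs symp_prod_index[OF hcat_carrier[OF X Y] hcat_carrier[OF U V] rs]
      symp_prod_index[OF X U] symp_prod_index[OF X V] symp_prod_index[OF Y U] symp_prod_index[OF Y V] colh[OF X Y rs(1)] colh[OF U V rs(2)]
    by auto
qed (use assms in \<open>auto simp: symp_prod_def hcat_def\<close>)

section \<open>SR decompositions of two columns\<close>

lemma mult_index_2:
  fixes A B :: "real mat"
  assumes "A \<in> carrier_mat m 2" "B \<in> carrier_mat 2 q" "r < m" "c < q"
  shows "(A * B) $$ (r, c) = A $$ (r, 0) * B $$ (0, c) + A $$ (r, 1) * B $$ (1, c)"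
proof -
  have "(A * B) $$ (r, c) = (\<Sum>l = 0..<2. A $$ (r, l) * B $$ (l, c))"
    using assms by (auto simp: scalar_prod_def intro!: sum.cong)
  then show ?thesis by (simp add: numeral_2_eq_2)
qed

lemma T0_hat_1_iff:
  "D \<in> T0_hat (Suc 0) \<longleftrightarrow> D \<in> carrier_mat 2 2 \<and> D $$ (0, Suc 0) = 0 \<and> D $$ (Suc 0, 0) = 0 \<and>
     D $$ (0, 0) > 0 \<and> \<bar>D $$ (Suc 0, Suc 0)\<bar> = D $$ (0, 0)"
  by (auto simp: T0_hat_def upper_triangular_def numeral_2_eq_2 less_Suc_eq)

lemma T0_hat_1_inverse:
  assumes "D \<in> T0_hat 1"
  obtains E where "E \<in> carrier_mat 2 2" "D * E = 1\<^sub>m 2"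
proof
  let ?E = "mat 2 2 (\<lambda>(r, c). if r = c then 1 / D $$ (r, r) else 0) :: real mat"
  show E: "?E \<in> carrier_mat 2 2" by simp
  have D: "D \<in> carrier_mat 2 2" using assms by (simp add: T0_hat_1_iff)
  show "D * ?E = 1\<^sub>m 2"
    using assms mult_index_2[OF D E] D
    by (intro eq_matI) (auto simp: T0_hat_1_iff numeral_2_eq_2 less_Suc_eq)
qed

lemma mat_add_diff_cancel:
  fixes A B :: "real mat"
  assumes "A \<in> carrier_mat m q" "B \<in> carrier_mat m q"
  shows "A + (B - A) = B" "A + B - A = B"
  using assms by (auto intro!: eq_matI)

lemma one_smult: "1 \<cdot>\<^sub>m (M :: real mat) = M"
  by (rule eq_matI) auto

text \<open>
  A skew symmetric \<open>2 \<times> 2\<close> matrix is a multiple of \<open>J\<^sub>2\<close>; the factor is the number \<open>\<omega>\<close> that the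
  DESR algorithm tests.
\<close>

lemma symp_prod_two_cols:
  assumes W: "W \<in> carrier_mat (2 * n) 2"
  shows "symp_prod n W W = symp_prod n W W $$ (0, 1) \<cdot>\<^sub>m block_J 1"
proof -
  let ?G = "symp_prod n W W"
  have G: "?G \<in> carrier_mat 2 2" using W by simp
  have skew: "?G $$ (r, c) = - ?G $$ (c, r)" if "r < 2" "c < 2" for r c
    using arg_cong[OF symp_prod_swap[OF W W], of "\<lambda>M. M $$ (r, c)"] that G by simp
  show ?thesis
    using G skew[of 0 0] skew[of 1 1] skew[of 1 0]
    by (intro eq_matI) (auto simp: block_J_def numeral_2_eq_2 less_Suc_eq)
qed

lemma symp_prod_scale_cols:
  assumes W: "W \<in> carrier_mat (2 * n) 2" and D: "D \<in> carrier_mat 2 2"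
    and diag: "D $$ (0, 1) = 0" "D $$ (1, 0) = 0"
  shows "symp_prod n (W * D) (W * D) $$ (0, 1) = D $$ (0, 0) * D $$ (1, 1) * symp_prod n W W $$ (0, 1)"
proof -
  let ?G = "symp_prod n W W"
  have G: "?G \<in> carrier_mat 2 2" and DG: "D\<^sup>T * ?G \<in> carrier_mat 2 2" using W D by auto
  have DT: "D\<^sup>T \<in> carrier_mat 2 2" using D by simp
  show ?thesis
    unfolding symp_prod_mult[OF W W D D]
    using mult_index_2[OF DG D, of 0 1] mult_index_2[OF DT G, of 0 1] D diag by simp
qed

text \<open>
  The determinant is \<open>\<omega>\<^sup>2\<close>, so it is nonzero exactly when DESR does not break down. Scaling the two
  columns by the reciprocals of \<open>r = \<surd>\<bar>\<omega>\<bar>\<close> and \<open>\<rho> = sgn(\<omega>) r\<close> turns their product into \<open>\<omega> / (r \<rho>) = 1\<close>.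
\<close>

lemma sr_factor_two_cols_exists:
  assumes W: "W \<in> carrier_mat (2 * n) 2" and nz: "det (symp_prod n W W) \<noteq> 0"
  obtains S D where "sr_factor n 1 W S D"
proof -
  define \<omega> where "\<omega> = symp_prod n W W $$ (0, 1)"
  have \<omega>: "\<omega> \<noteq> 0"
  proof
    assume "\<omega> = 0"
    then have "symp_prod n W W = 0 \<cdot>\<^sub>m block_J 1"
      using symp_prod_two_cols[OF W] by (simp add: \<omega>_def)
    then show False using nz by (simp add: det_smult)
  qed
  define r \<rho> where "r = sqrt \<bar>\<omega>\<bar>" and "\<rho> = sgn \<omega> * r"
  have r: "r > 0" "r * r = \<bar>\<omega>\<bar>" using \<omega> by (auto simp: r_def)
  then have \<rho>: "\<bar>\<rho>\<bar> = r" "\<rho> \<noteq> 0" "r * \<rho> = \<omega>" using \<omega> by (auto simp: \<rho>_def sgn_if abs_mult)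
  define D E where "D = mat 2 2 (\<lambda>(a, b). if a \<noteq> b then 0 else if a = 0 then r else \<rho>)"
    and "E = mat 2 2 (\<lambda>(a, b). if a \<noteq> b then 0 else if a = 0 then 1 / r else 1 / \<rho>)"
  have D: "D \<in> carrier_mat 2 2" and E: "E \<in> carrier_mat 2 2" by (auto simp: D_def E_def)
  have ED: "E * D = 1\<^sub>m 2"
    using mult_index_2[OF E D] r \<rho>
    by (intro eq_matI) (auto simp: D_def E_def numeral_2_eq_2 less_Suc_eq)
  have WE: "W * E \<in> carrier_mat (2 * n) 2" using W E by simp
  have "symp_prod n (W * E) (W * E) $$ (0, 1) = 1 / r * (1 / \<rho>) * \<omega>"
    using symp_prod_scale_cols[OF W E] by (simp add: E_def \<omega>_def)
  also have "\<dots> = 1" unfolding \<rho>(3)[symmetric] using r(1) \<rho>(2) by simp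
  finally have "symp_prod n (W * E) (W * E) = block_J 1"
    by (subst symp_prod_two_cols[OF WE]) (simp add: one_smult)
  moreover have "W = W * E * D" using W assoc_mult_mat[OF W E D] ED by simp
  moreover have "D \<in> T0_hat 1" using r \<rho> by (simp add: T0_hat_1_iff D_def)
  ultimately have "sr_factor n 1 W (W * E) D" using WE by (simp add: sr_factor_def)
  then show ?thesis by (rule that)
qed

text \<open>
  DESR has no freedom: in any decomposition \<open>W = S D\<close> the diagonal entries satisfy \<open>r \<rho> = \<omega>\<close> and
  \<open>\<bar>\<rho>\<bar> = r > 0\<close>, which forces \<open>r = \<surd>\<bar>\<omega>\<bar>\<close> and \<open>\<rho> = sgn(\<omega>) r\<close>, and \<open>D\<close> is invertible.
  So every decomposition of two columns is the one that DESR returns.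
\<close>

lemma desr_sr_factor:
  assumes "sr_factor n 1 W S D"
  shows "desr n W = Some (S, D)"
proof -
  have S: "S \<in> carrier_mat (2 * n) 2" and SS: "symp_prod n S S = block_J 1"
    and "D \<in> T0_hat 1" and W: "W = S * D"
    using assms by (auto simp: sr_factor_def)
  then have D: "D \<in> carrier_mat 2 2" and diag: "D $$ (0, 1) = 0" "D $$ (1, 0) = 0"
    and pos: "D $$ (0, 0) > 0" "\<bar>D $$ (1, 1)\<bar> = D $$ (0, 0)" by (auto simp: T0_hat_1_iff)
  have Wc: "W \<in> carrier_mat (2 * n) 2" using S D W by simp
  define r \<rho> where "r = D $$ (0, 0)" and "\<rho> = D $$ (1, 1)"
  have r: "r > 0" "\<rho> \<noteq> 0" "\<bar>\<rho>\<bar> = r" using pos by (auto simp: r_def \<rho>_def)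
  have "col W 0 \<bullet> (J_mat n *\<^sub>v col W 1) = symp_prod n W W $$ (0, 1)"
    using symp_prod_index[OF Wc Wc] by simp
  also have "\<dots> = r * \<rho>"
    unfolding W symp_prod_scale_cols[OF S D diag] SS by (simp add: r_def \<rho>_def block_J_def)
  finally have om: "col W 0 \<bullet> (J_mat n *\<^sub>v col W 1) = r * \<rho>" .
  have sq: "sqrt \<bar>r * \<rho>\<bar> = r" using r by (simp add: abs_mult)
  have sg: "sgn (r * \<rho>) * r = \<rho>" using r by (auto simp: sgn_mult sgn_if abs_if split: if_splits)
  have WI: "W $$ (i, c) = S $$ (i, 0) * D $$ (0, c) + S $$ (i, 1) * D $$ (1, c)" if "i < 2 * n" "c < 2" for i c
    unfolding W using mult_index_2[OF S D that] .
  have "mat_of_cols (2 * n) [(1 / r) \<cdot>\<^sub>v col W 0, (1 / \<rho>) \<cdot>\<^sub>v col W 1] = S"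
    using S Wc WI r diag r_def \<rho>_def
    by (intro eq_matI) (auto simp: mat_of_cols_def numeral_2_eq_2 less_Suc_eq)
  moreover have "mat_diag 2 (\<lambda>i. if i = 0 then r else \<rho>) = D"
    using D diag by (intro eq_matI) (auto simp: mat_diag_def r_def \<rho>_def numeral_2_eq_2 less_Suc_eq)
  ultimately show ?thesis
    using r unfolding desr_def Let_def om sq sg by simp
qed

section \<open>Adding two columns to a decomposition\<close>

lemma T0_hat_carrier: "R \<in> T0_hat k \<Longrightarrow> R \<in> carrier_mat (2 * k) (2 * k)"
  by (simp add: T0_hat_def)

lemma T0_hat_four_block:
  assumes R: "R \<in> carrier_mat (2 * j) (2 * j)" and D: "D \<in> carrier_mat 2 2"
  shows "four_block_mat R C (0\<^sub>m 2 (2 * j)) D \<in> T0_hat (Suc j) \<longleftrightarrow> R \<in> T0_hat j \<and> D \<in> T0_hat 1"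
    (is "?M \<in> _ \<longleftrightarrow> _")
proof
  assume M: "?M \<in> T0_hat (Suc j)"
  have ut: "?M $$ (r, c) = 0" if "c < r" "r < 2 * Suc j" for r c
    using M that R D unfolding T0_hat_def upper_triangular_def by auto
  have dg: "?M $$ (2 * i, 2 * i + 1) = 0 \<and> ?M $$ (2 * i, 2 * i) > 0 \<and>
      \<bar>?M $$ (2 * i + 1, 2 * i + 1)\<bar> = ?M $$ (2 * i, 2 * i)" if "i < Suc j" for i
    using M that unfolding T0_hat_def by auto
  have "upper_triangular R"
  proof (rule upper_triangularI)
    fix r c assume "c < r" "r < dim_row R"
    then show "R $$ (r, c) = 0" using ut[of c r] R D by auto
  qed
  moreover have "R $$ (2 * i, 2 * i + 1) = 0 \<and> R $$ (2 * i, 2 * i) > 0 \<and>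
      \<bar>R $$ (2 * i + 1, 2 * i + 1)\<bar> = R $$ (2 * i, 2 * i)" if "i < j" for i
    using dg[of i] that R D by auto
  moreover have "D \<in> T0_hat 1"
    using dg[of j] ut[of "2 * j" "2 * j + 1"] R D by (auto simp: T0_hat_1_iff)
  ultimately show "R \<in> T0_hat j \<and> D \<in> T0_hat 1" using R by (auto simp: T0_hat_def)
next
  assume RD: "R \<in> T0_hat j \<and> D \<in> T0_hat 1"
  have "upper_triangular ?M"
    by (rule upper_triangular_four_block[of _ "2 * j" _ 2]) (use RD R D in \<open>auto simp: T0_hat_def\<close>)
  moreover have "?M \<in> carrier_mat (2 * Suc j) (2 * Suc j)" using R D by auto
  moreover have "?M $$ (2 * i, 2 * i + 1) = 0 \<and> ?M $$ (2 * i, 2 * i) > 0 \<and>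
      \<bar>?M $$ (2 * i + 1, 2 * i + 1)\<bar> = ?M $$ (2 * i, 2 * i)" if "i < Suc j" for i
  proof (cases "i = j")
    case True
    then show ?thesis using RD R D by (auto simp: T0_hat_1_iff)
  next
    case False
    then show ?thesis using RD R D that by (auto simp: T0_hat_def)
  qed
  ultimately show "?M \<in> T0_hat (Suc j)" by (auto simp: T0_hat_def)
qed

lemma T0_hat_Suc_cases:
  assumes "M \<in> T0_hat (Suc j)"
  obtains R C D where "R \<in> T0_hat j" "C \<in> carrier_mat (2 * j) 2" "D \<in> T0_hat 1"
    "M = four_block_mat R C (0\<^sub>m 2 (2 * j)) D"
proof -
  obtain R C Z D where sp: "split_block M (2 * j) (2 * j) = (R, C, Z, D)"
    by (rule prod_cases4)
  have M: "dim_row M = 2 * j + 2" "dim_col M = 2 * j + 2" using T0_hat_carrier[OF assms] by auto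
  note c = split_block[OF sp M]
  have "Z = 0\<^sub>m 2 (2 * j)"
  proof (rule eq_matI)
    fix r s assume "r < dim_row (0\<^sub>m 2 (2 * j) :: real mat)" "s < dim_col (0\<^sub>m 2 (2 * j) :: real mat)"
    then have rs: "r < 2" "s < 2 * j" by auto
    have "M $$ (2 * j + r, s) = 0"
      using assms rs M by (auto simp: T0_hat_def upper_triangular_def)
    then show "Z $$ (r, s) = 0\<^sub>m 2 (2 * j) $$ (r, s)" using rs c by auto
  qed (use c in auto)
  then have eq: "M = four_block_mat R C (0\<^sub>m 2 (2 * j)) D" using c(5) by simp
  then have "R \<in> T0_hat j \<and> D \<in> T0_hat 1" using T0_hat_four_block[OF c(1,4)] assms by simp
  then show ?thesis using that c(2) eq by blast
qed

text \<open>
  Projecting the new columns along the span of \<open>S\<close>: since \<open>S\<^sup>T J S = \<Omega>\<close> with \<open>\<Omega> \<Omega>\<^sup>T = I\<close>, the coefficients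
  \<open>\<Omega>\<^sup>T S\<^sup>T J E\<close> leave a remainder orthogonal to \<open>S\<close> with respect to \<open>J\<close>.
\<close>

lemma symp_prod_residual:
  assumes S: "S \<in> carrier_mat (2 * n) (2 * j)" and E: "E \<in> carrier_mat (2 * n) 2"
    and SS: "symp_prod n S S = block_J j"
  shows "symp_prod n S (E - S * ((block_J j)\<^sup>T * symp_prod n S E)) = 0\<^sub>m (2 * j) 2"
proof -
  let ?C = "(block_J j)\<^sup>T * symp_prod n S E"
  have SE: "symp_prod n S E \<in> carrier_mat (2 * j) 2" using S E by simp
  have C: "?C \<in> carrier_mat (2 * j) 2" by (rule mult_carrier_mat[OF _ SE]) simp
  have "symp_prod n S (S * ?C) = block_J j * ?C"
    using symp_prod_mult_right[OF S S C] SS by simp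
  also have "\<dots> = block_J j * (block_J j)\<^sup>T * symp_prod n S E"
    by (rule assoc_mult_mat[symmetric, of _ "2 * j" "2 * j" _ "2 * j" _ 2]) (use SE in auto)
  also have "\<dots> = symp_prod n S E" using SE by (simp add: block_J_orthogonal')
  finally have "symp_prod n S (S * ?C) = symp_prod n S E" .
  moreover have "S * ?C \<in> carrier_mat (2 * n) 2" by (rule mult_carrier_mat[OF S C])
  ultimately show ?thesis using symp_prod_minus_right[OF S E, of "S * ?C"] SE by simp
qed

text \<open>
  The remainder \<open>E - S C = T D\<close> is orthogonal to \<open>S\<close> and \<open>D\<close> is invertible, so \<open>T\<close> is orthogonal to \<open>S\<close> as well.
  This makes the product of \<open>[S, T]\<close> with itself block diagonal.
\<close>

lemma sr_factor_extend:
  assumes E: "E \<in> carrier_mat (2 * n) 2"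
    and f: "sr_factor n j B S R" and C_def: "C = (block_J j)\<^sup>T * symp_prod n S E"
    and g: "sr_factor n 1 (E - S * C) T D"
  shows "sr_factor n (Suc j) (hcat B E) (hcat S T) (four_block_mat R C (0\<^sub>m 2 (2 * j)) D)"
proof -
  have S: "S \<in> carrier_mat (2 * n) (2 * j)" and SS: "symp_prod n S S = block_J j"
    and R: "R \<in> T0_hat j" and B: "B = S * R" using f by (auto simp: sr_factor_def)
  have T: "T \<in> carrier_mat (2 * n) 2" and TT: "symp_prod n T T = block_J 1"
    and D: "D \<in> T0_hat 1" and W: "E - S * C = T * D" using g by (auto simp: sr_factor_def)
  have Rc: "R \<in> carrier_mat (2 * j) (2 * j)" and Dc: "D \<in> carrier_mat 2 2"
    using T0_hat_carrier[OF R] T0_hat_carrier[OF D] by auto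
  have C: "C \<in> carrier_mat (2 * j) 2"
    unfolding C_def by (rule mult_carrier_mat[of _ _ "2 * j"]) (use S E in auto)
  have SC: "S * C \<in> carrier_mat (2 * n) 2" by (rule mult_carrier_mat[OF S C])
  obtain D' where D': "D' \<in> carrier_mat 2 2" "D * D' = 1\<^sub>m 2" using T0_hat_1_inverse[OF D] .
  have "T = T * D * D'" using assoc_mult_mat[OF T Dc D'(1)] D'(2) T by simp
  then have "symp_prod n S T = symp_prod n S (T * D * D')" by simp
  also have "\<dots> = symp_prod n S (T * D) * D'"
    by (rule symp_prod_mult_right[OF S _ D'(1)]) (use T Dc in auto)
  also have "symp_prod n S (T * D) = 0\<^sub>m (2 * j) 2"
    using symp_prod_residual[OF S E SS] W by (simp add: C_def)
  finally have ST: "symp_prod n S T = 0\<^sub>m (2 * j) 2" using D' by simp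
  have TS: "symp_prod n T S = 0\<^sub>m 2 (2 * j)"
    unfolding symp_prod_swap[OF S T] ST by (intro eq_matI) auto
  have "S * C + T * D = E" unfolding W[symmetric] by (rule mat_add_diff_cancel(1)[OF SC E])
  then have "hcat B E = hcat S T * four_block_mat R C (0\<^sub>m 2 (2 * j)) D"
    unfolding hcat_mult_upper[OF S T Rc C Dc] B by simp
  moreover have "symp_prod n (hcat S T) (hcat S T) = block_J (Suc j)"
    unfolding symp_prod_hcat[OF S T S T] SS ST TS TT block_J_Suc ..
  moreover have "four_block_mat R C (0\<^sub>m 2 (2 * j)) D \<in> T0_hat (Suc j)"
    using T0_hat_four_block[OF Rc Dc] R D by blast
  ultimately show ?thesis using hcat_carrier[OF S T] by (simp add: sr_factor_def)
qed

text \<open>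
  The converse of the preceding lemma, and the source of uniqueness: multiplying \<open>E = S C + T D\<close> by
  \<open>\<Omega>\<^sup>T S\<^sup>T J\<close> gives back \<open>C\<close>, so the coefficients of the last two columns are determined by \<open>S\<close> and \<open>E\<close>.
\<close>

lemma sr_factor_Suc_cases:
  assumes B: "B \<in> carrier_mat (2 * n) (2 * j)" and E: "E \<in> carrier_mat (2 * n) 2"
    and f: "sr_factor n (Suc j) (hcat B E) S' R'"
  obtains S T R C D where
    "S' = hcat S T" "R' = four_block_mat R C (0\<^sub>m 2 (2 * j)) D"
    "sr_factor n j B S R" "C = (block_J j)\<^sup>T * symp_prod n S E" "sr_factor n 1 (E - S * C) T D"
proof -
  have S': "S' \<in> carrier_mat (2 * n) (2 * j + 2)" and SS': "symp_prod n S' S' = block_J (Suc j)"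
    and R': "R' \<in> T0_hat (Suc j)" and BE: "hcat B E = S' * R'"
    using f by (auto simp: sr_factor_def)
  obtain S T where S: "S \<in> carrier_mat (2 * n) (2 * j)" and T: "T \<in> carrier_mat (2 * n) 2"
    and S'_eq: "S' = hcat S T" using hcat_cases[OF S'] .
  obtain R C D where R: "R \<in> T0_hat j" and C: "C \<in> carrier_mat (2 * j) 2" and D: "D \<in> T0_hat 1"
    and R'_eq: "R' = four_block_mat R C (0\<^sub>m 2 (2 * j)) D" using T0_hat_Suc_cases[OF R'] .
  have Rc: "R \<in> carrier_mat (2 * j) (2 * j)" and Dc: "D \<in> carrier_mat 2 2"
    using T0_hat_carrier[OF R] T0_hat_carrier[OF D] by auto
  have "four_block_mat (symp_prod n S S) (symp_prod n S T) (symp_prod n T S) (symp_prod n T T)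
     = four_block_mat (block_J j) (0\<^sub>m (2 * j) 2) (0\<^sub>m 2 (2 * j)) (block_J 1)"
    using SS' unfolding S'_eq symp_prod_hcat[OF S T S T] block_J_Suc .
  then have "symp_prod n S S = block_J j \<and> symp_prod n S T = 0\<^sub>m (2 * j) 2 \<and>
      symp_prod n T S = 0\<^sub>m 2 (2 * j) \<and> symp_prod n T T = block_J 1"
    by (subst (asm) four_block_mat_inject[of _ "2 * j" "2 * j" _ _ 2 _ _ 2])
      (use S T block_J_carrier[of 1] in auto)
  then have SS: "symp_prod n S S = block_J j" and ST: "symp_prod n S T = 0\<^sub>m (2 * j) 2"
    and TT: "symp_prod n T T = block_J 1" by auto
  have SR: "S * R \<in> carrier_mat (2 * n) (2 * j)" and SC: "S * C \<in> carrier_mat (2 * n) 2"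
    and TD: "T * D \<in> carrier_mat (2 * n) 2"
    using S T Rc C Dc by auto
  have "hcat B E = hcat (S * R) (S * C + T * D)"
    using BE unfolding S'_eq R'_eq hcat_mult_upper[OF S T Rc C Dc] .
  then have "B = S * R \<and> E = S * C + T * D"
    by (subst (asm) hcat_inject[OF B SR E]) (use SC TD in auto)
  then have BS: "B = S * R" and ES: "E = S * C + T * D" by auto
  have "E - S * C = T * D" unfolding ES by (rule mat_add_diff_cancel(2)[OF SC TD])
  then have g: "sr_factor n 1 (E - S * C) T D" using T TT D by (simp add: sr_factor_def)
  have "symp_prod n S E = symp_prod n S (S * C) + symp_prod n S (T * D)"
    unfolding ES by (rule symp_prod_add_right[OF S SC TD])
  also have "symp_prod n S (S * C) = block_J j * C" using symp_prod_mult_right[OF S S C] SS by simp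
  also have "symp_prod n S (T * D) = 0\<^sub>m (2 * j) 2" using symp_prod_mult_right[OF S T Dc] ST Dc by simp
  finally have "symp_prod n S E = block_J j * C"
    using mult_carrier_mat[OF block_J_carrier C] by simp
  then have "(block_J j)\<^sup>T * symp_prod n S E = (block_J j)\<^sup>T * block_J j * C"
    using assoc_mult_mat[of "(block_J j)\<^sup>T" "2 * j" "2 * j" "block_J j" "2 * j" C 2] C by simp
  then have "C = (block_J j)\<^sup>T * symp_prod n S E" using C by (simp add: block_J_orthogonal)
  moreover have "sr_factor n j B S R" using S SS R BS by (simp add: sr_factor_def)
  ultimately show ?thesis using that[OF S'_eq R'_eq] g by blast
qed

section \<open>Existence\<close>

lemma first_cols_carrier [simp]:
  "B \<in> carrier_mat m q \<Longrightarrow> first_cols B p \<in> carrier_mat m p"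
  by (auto simp: first_cols_def)

lemma first_cols_all: "B \<in> carrier_mat m q \<Longrightarrow> first_cols B q = B"
  by (intro eq_matI) (auto simp: first_cols_def)

lemma col_block_carrier [simp]:
  "B \<in> carrier_mat m q \<Longrightarrow> col_block B j \<in> carrier_mat m 2"
  by (auto simp: col_block_def)

lemma first_cols_Suc_block:
  assumes "B \<in> carrier_mat m q"
  shows "first_cols B (2 * Suc j) = hcat (first_cols B (2 * j)) (col_block B j)"
  using assms by (intro eq_matI) (auto simp: first_cols_def col_block_def hcat_def)

lemma submatrix_lessThan:
  assumes A: "A \<in> carrier_mat p q" and m: "m \<le> p" "m \<le> q"
  shows "submatrix A {..<m} {..<m} = mat m m (\<lambda>rc. A $$ rc)"
proof -
  have "{i. i < p \<and> i < m} = {..<m}" "{i. i < q \<and> i < m} = {..<m}" using m by auto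
  moreover have pick: "pick {..<m} i = i" if "i < m" for i
  proof -
    have "{a \<in> {..<m}. a < i} = {..<i}" using that by auto
    then show ?thesis using pick_card_in_set[of i "{..<m}"] that by simp
  qed
  ultimately show ?thesis using A pick by (intro eq_matI) (auto simp: submatrix_def)
qed

lemma leading_principal_symp_prod:
  assumes B: "B \<in> carrier_mat (2 * n) q" and m: "m \<le> q"
  shows "leading_principal (symp_prod n B B) m = symp_prod n (first_cols B m) (first_cols B m)"
proof -
  have G: "symp_prod n B B \<in> carrier_mat q q" and F: "first_cols B m \<in> carrier_mat (2 * n) m"
    using B by auto
  have colF: "col (first_cols B m) s = col B s" if "s < m" for s
    using B m that by (intro eq_vecI) (auto simp: first_cols_def)
  show ?thesis
    unfolding leading_principal_def submatrix_lessThan[OF G m m]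
    using symp_prod_index[OF B B] symp_prod_index[OF F F] symp_prod_carrier[OF F F] colF m
    by (intro eq_matI) auto
qed

text \<open>
  Induction on the number of column pairs. Let \<open>W\<close> be the remainder of the next pair \<open>E\<close>. The first
  \<open>2 (j + 1)\<close> columns are \<open>[S, W]\<close> times a square matrix, so the nonzero minor contains the determinant of
  \<open>[S, W]\<^sup>T J [S, W] = diag(\<Omega>, W\<^sup>T J W)\<close> as a factor. Hence \<open>W\<^sup>T J W\<close> is nonsingular and the two columns of
  \<open>W\<close> can be normalised.
\<close>

lemma sr_factor_exists:
  assumes B: "B \<in> carrier_mat (2 * n) (2 * k)"
    and nz: "\<And>j. 1 \<le> j \<Longrightarrow> j \<le> k \<Longrightarrow> det (leading_principal (symp_prod n B B) (2 * j)) \<noteq> 0"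
    and "j \<le> k"
  shows "\<exists>S R. sr_factor n j (first_cols B (2 * j)) S R"
  using \<open>j \<le> k\<close>
proof (induction j)
  case 0
  have "sr_factor n 0 (first_cols B 0) (0\<^sub>m (2 * n) 0) (0\<^sub>m 0 0)"
    using B by (auto simp: sr_factor_def T0_hat_def first_cols_def symp_prod_def block_J_def intro!: eq_matI)
  then show ?case by auto
next
  case (Suc j)
  then obtain S R where f: "sr_factor n j (first_cols B (2 * j)) S R" by auto
  then have S: "S \<in> carrier_mat (2 * n) (2 * j)" and SS: "symp_prod n S S = block_J j"
    and R: "R \<in> carrier_mat (2 * j) (2 * j)" and BS: "first_cols B (2 * j) = S * R"
    using T0_hat_carrier by (auto simp: sr_factor_def)
  define E C W where "E = col_block B j" and "C = (block_J j)\<^sup>T * symp_prod n S E" and "W = E - S * C"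
  have E: "E \<in> carrier_mat (2 * n) 2" using B by (simp add: E_def)
  have C: "C \<in> carrier_mat (2 * j) 2"
    unfolding C_def by (rule mult_carrier_mat[of _ _ "2 * j"]) (use S E in auto)
  have SC: "S * C \<in> carrier_mat (2 * n) 2" by (rule mult_carrier_mat[OF S C])
  have W: "W \<in> carrier_mat (2 * n) 2" unfolding W_def by (rule minus_carrier_mat[OF SC])
  let ?B = "first_cols B (2 * Suc j)" and ?T = "hcat S W" and ?M = "four_block_mat R C (0\<^sub>m 2 (2 * j)) (1\<^sub>m 2)"
  have "S * C + W * 1\<^sub>m 2 = E"
    unfolding right_mult_one_mat[OF W] unfolding W_def by (rule mat_add_diff_cancel(1)[OF SC E])
  then have BT: "?B = ?T * ?M"
    unfolding hcat_mult_upper[OF S W R C one_carrier_mat] first_cols_Suc_block[OF B] BS E_def by simp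
  have T: "?T \<in> carrier_mat (2 * n) (2 * j + 2)" by (rule hcat_carrier[OF S W])
  have M: "?M \<in> carrier_mat (2 * j + 2) (2 * j + 2)" by (rule four_block_carrier_mat[OF R one_carrier_mat])
  have G: "symp_prod n ?T ?T \<in> carrier_mat (2 * j + 2) (2 * j + 2)" by (rule symp_prod_carrier[OF T T])
  have MG: "?M\<^sup>T * symp_prod n ?T ?T \<in> carrier_mat (2 * j + 2) (2 * j + 2)"
    by (rule mult_carrier_mat[OF _ G]) (use M in auto)
  \<comment> \<open>The minor of order \<open>2 (j + 1)\<close> is a product of three determinants.\<close>
  have "det (symp_prod n ?B ?B) \<noteq> 0"
    using nz[of "Suc j"] Suc.prems leading_principal_symp_prod[OF B, of "2 * Suc j"] by simp
  also have "symp_prod n ?B ?B = ?M\<^sup>T * symp_prod n ?T ?T * ?M"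
    unfolding BT by (rule symp_prod_mult[OF T T M M])
  also have "det \<dots> = det (?M\<^sup>T) * det (symp_prod n ?T ?T) * det ?M"
    unfolding det_mult[OF MG M] using det_mult[OF _ G, of "?M\<^sup>T"] M by simp
  finally have "det (symp_prod n ?T ?T) \<noteq> 0" by auto
  moreover have SW: "symp_prod n S W = 0\<^sub>m (2 * j) 2"
    unfolding W_def C_def by (rule symp_prod_residual[OF S E SS])
  moreover have "symp_prod n W S = 0\<^sub>m 2 (2 * j)"
    unfolding symp_prod_swap[OF S W] SW by (intro eq_matI) auto
  ultimately have "det (four_block_mat (block_J j) (0\<^sub>m (2 * j) 2) (0\<^sub>m 2 (2 * j)) (symp_prod n W W)) \<noteq> 0"
    unfolding symp_prod_hcat[OF S W S W] SS by simp
  then have "det (symp_prod n W W) \<noteq> 0"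
    using det_four_block_mat_lower_left_zero[of "block_J j" "2 * j" "0\<^sub>m (2 * j) 2" 2 _ "symp_prod n W W"] W
    by simp
  then obtain T D where "sr_factor n 1 W T D" by (rule sr_factor_two_cols_exists[OF W])
  then have "sr_factor n (Suc j) (hcat (first_cols B (2 * j)) E) (hcat S T) (four_block_mat R C (0\<^sub>m 2 (2 * j)) D)"
    using sr_factor_extend[OF E f C_def] by (simp add: W_def)
  then show ?case unfolding first_cols_Suc_block[OF B] E_def by blast
qed

section \<open>The algorithm returns every decomposition\<close>

lemma sum_lessThan_double: "(\<Sum>l = 0..<2 * j. f l) = (\<Sum>i<j. f (2 * i) + f (2 * i + 1))" for f :: "nat \<Rightarrow> real"
  by (induction j) (auto simp: algebra_simps)

text \<open>
  The start matrix \<open>Z\<close> is general because the induction peels off the last summand, which \<^const>\<open>foldr\<close>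
  adds to \<open>Z\<close> first.
\<close>

lemma foldr_add_mat:
  fixes Z :: "real mat"
  assumes "\<And>i. i < j \<Longrightarrow> f i \<in> carrier_mat m q" "Z \<in> carrier_mat m q"
  shows "foldr (+) (map f [0..<j]) Z \<in> carrier_mat m q \<and>
    (\<forall>r<m. \<forall>c<q. foldr (+) (map f [0..<j]) Z $$ (r, c) = (\<Sum>i<j. f i $$ (r, c)) + Z $$ (r, c))"
  using assms
proof (induction j arbitrary: Z)
  case (Suc j)
  have fZ: "f j \<in> carrier_mat m q" "f j + Z \<in> carrier_mat m q" using Suc.prems by auto
  show ?case using Suc.IH[of "f j + Z"] Suc.prems fZ by auto
qed simp

lemma sum_of_block_products:
  assumes S: "S \<in> carrier_mat m (2 * j)" and C: "C \<in> carrier_mat (2 * j) 2"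
  shows "foldr (+) (map2 (*) (map (col_block S) [0..<j]) (map (row_block C) [0..<j])) (0\<^sub>m m 2) = S * C"
proof -
  have map2: "map2 (*) (map (col_block S) [0..<j]) (map (row_block C) [0..<j])
      = map (\<lambda>i. col_block S i * row_block C i) [0..<j]"
    by (simp add: zip_map_map zip_same_conv_map)
  have cS: "col_block S i \<in> carrier_mat m 2" and cC: "row_block C i \<in> carrier_mat 2 2" for i
    using S C by (auto simp: col_block_def row_block_def)
  have p: "col_block S i * row_block C i \<in> carrier_mat m 2" for i
    by (rule mult_carrier_mat[OF cS cC])
  note fa = foldr_add_mat[of j "\<lambda>i. col_block S i * row_block C i" m 2 "0\<^sub>m m 2", OF p zero_carrier_mat]
  show ?thesis unfolding map2
  proof (rule eq_matI)
    fix r c assume "r < dim_row (S * C)" "c < dim_col (S * C)"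
    then have rc: "r < m" "c < 2" using S C by auto
    have "(S * C) $$ (r, c) = (\<Sum>l = 0..<2 * j. S $$ (r, l) * C $$ (l, c))"
      using S C rc by (auto simp: scalar_prod_def intro!: sum.cong)
    also have "\<dots> = (\<Sum>i<j. S $$ (r, 2 * i) * C $$ (2 * i, c) + S $$ (r, 2 * i + 1) * C $$ (2 * i + 1, c))"
      by (rule sum_lessThan_double)
    also have "\<dots> = (\<Sum>i<j. (col_block S i * row_block C i) $$ (r, c))"
      using S C rc mult_index_2[OF cS cC rc] by (intro sum.cong refl) (simp add: col_block_def row_block_def)
    finally show "foldr (+) (map (\<lambda>i. col_block S i * row_block C i) [0..<j]) (0\<^sub>m m 2) $$ (r, c) = (S * C) $$ (r, c)"
      using fa rc by simp
  qed (use fa S C in auto)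
qed

lemma row_block_symp_prod:
  assumes S: "S \<in> carrier_mat (2 * n) (2 * j)" and E: "E \<in> carrier_mat (2 * n) q" and i: "i < j"
  shows "row_block (symp_prod n S E) i = symp_prod n (col_block S i) E"
proof (rule eq_matI)
  have cS: "col_block S i \<in> carrier_mat (2 * n) 2" using S by simp
  fix r c assume "r < dim_row (symp_prod n (col_block S i) E)" "c < dim_col (symp_prod n (col_block S i) E)"
  then have rc: "r < 2" "c < q" using symp_prod_carrier[OF cS E] by auto
  have "col (col_block S i) r = col S (2 * i + r)"
    using S i rc by (intro eq_vecI) (auto simp: col_block_def)
  then show "row_block (symp_prod n S E) i $$ (r, c) = symp_prod n (col_block S i) E $$ (r, c)"
    using symp_prod_index[OF cS E rc] symp_prod_index[OF S E, of "2 * i + r" c] i rc symp_prod_carrier[OF S E]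
    by (simp add: row_block_def)
qed (use S E in \<open>auto simp: row_block_def symp_prod_def col_block_def\<close>)

text \<open>
  The blocks \<open>J\<^sub>2\<^sup>T S\<^sub>i\<^sup>T J E\<close> computed one by one are the row blocks of the single matrix \<open>\<Omega>\<^sup>T S\<^sup>T J E\<close>
  that occurs when a decomposition is taken apart.
\<close>

lemma bsgs_coefficients:
  assumes S: "S \<in> carrier_mat (2 * n) (2 * j)" and E: "E \<in> carrier_mat (2 * n) 2"
  shows "map (\<lambda>Si. (J_mat 1)\<^sup>T * Si\<^sup>T * J_mat n * E) (map (col_block S) [0..<j])
    = map (row_block ((block_J j)\<^sup>T * symp_prod n S E)) [0..<j]"
proof -
  have "(J_mat 1)\<^sup>T * (col_block S i)\<^sup>T * J_mat n * E = row_block ((block_J j)\<^sup>T * symp_prod n S E) i"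
    if i: "i < j" for i
  proof -
    let ?J = "(J_mat 1)\<^sup>T" and ?Si = "(col_block S i)\<^sup>T"
    have J1: "?J \<in> carrier_mat 2 2" using J_mat_carrier[of 1] by simp
    have Si: "?Si \<in> carrier_mat 2 (2 * n)" using S by simp
    have SiJ: "?Si * J_mat n \<in> carrier_mat 2 (2 * n)" by (rule mult_carrier_mat[OF Si]) simp
    have "?J * ?Si * J_mat n * E = ?J * (?Si * J_mat n) * E"
      using assoc_mult_mat[OF J1 Si J_mat_carrier] by simp
    also have "\<dots> = ?J * symp_prod n (col_block S i) E"
      unfolding symp_prod_def by (rule assoc_mult_mat[OF J1 SiJ E])
    also have "\<dots> = row_block ((block_J j)\<^sup>T * symp_prod n S E) i"
      using row_block_transpose_block_J[OF symp_prod_carrier[OF S E] i] row_block_symp_prod[OF S E i]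
      by (simp add: block_J_1[unfolded One_nat_def])
    finally show ?thesis .
  qed
  then show ?thesis by simp
qed

text \<open>
  Given any decomposition, the algorithm finds its blocks: \<open>sr_factor_Suc_cases\<close> says that the
  last columns have the coefficients which the algorithm computes, and \<open>desr_sr_factor\<close> that the remaining
  two columns are normalised in the same way. In particular it does not break down.
\<close>

lemma bsgs_blocks_sr_factor:
  assumes B: "B \<in> carrier_mat (2 * n) q"
    and "sr_factor n j (first_cols B (2 * j)) S R"
  shows "bsgs_blocks n B j = Some (map (col_block S) [0..<j],
    map (\<lambda>c. map (row_block (col_block R c)) [0..<Suc c]) [0..<j])"
  using assms(2)
proof (induction j arbitrary: S R)
  case (Suc j S' R')
  let ?E = "col_block B j"
  have E: "?E \<in> carrier_mat (2 * n) 2" using B by simp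
  obtain S T R C D where eqs: "S' = hcat S T" "R' = four_block_mat R C (0\<^sub>m 2 (2 * j)) D"
    and f: "sr_factor n j (first_cols B (2 * j)) S R" and C_def: "C = (block_J j)\<^sup>T * symp_prod n S ?E"
    and g: "sr_factor n 1 (?E - S * C) T D"
    by (rule sr_factor_Suc_cases[OF first_cols_carrier[OF B] E Suc.prems[unfolded first_cols_Suc_block[OF B]]])
  have S: "S \<in> carrier_mat (2 * n) (2 * j)" and R: "R \<in> carrier_mat (2 * j) (2 * j)"
    and T: "T \<in> carrier_mat (2 * n) 2" and D: "D \<in> carrier_mat 2 2"
    using f g T0_hat_carrier[of R j] T0_hat_carrier[of D 1] by (auto simp: sr_factor_def)
  have C: "C \<in> carrier_mat (2 * j) 2"
    unfolding C_def by (rule mult_carrier_mat[of _ _ "2 * j"]) (use S E in auto)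
  have Rs: "map (\<lambda>Si. (J_mat 1)\<^sup>T * Si\<^sup>T * J_mat n * ?E) (map (col_block S) [0..<j]) = map (row_block C) [0..<j]"
    unfolding C_def by (rule bsgs_coefficients[OF S E])
  have step: "bsgs_blocks n B (Suc j) = Some (map (col_block S) [0..<j] @ [T],
      map (\<lambda>c. map (row_block (col_block R c)) [0..<Suc c]) [0..<j] @ [map (row_block C) [0..<j] @ [D]])"
    unfolding bsgs_blocks.simps Suc.IH[OF f] Option.bind.simps prod.case Let_def Rs
      sum_of_block_products[OF S C] desr_sr_factor[OF g] by simp
  have "col_block S' i = col_block S i" if "i < j" for i
    using that S T by (auto simp: eqs col_block_def hcat_def intro!: eq_matI)
  moreover have "col_block S' j = T"
    using S T by (auto simp: eqs col_block_def hcat_def intro!: eq_matI)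
  moreover have "row_block (col_block R' c) i = row_block (col_block R c) i" if "c < j" "i \<le> c" for c i
    using that R C D by (auto simp: eqs col_block_def row_block_def intro!: eq_matI)
  moreover have "row_block (col_block R' j) i = row_block C i" if "i < j" for i
    using that R C D by (auto simp: eqs col_block_def row_block_def intro!: eq_matI)
  moreover have "row_block (col_block R' j) j = D"
    using R C D by (auto simp: eqs col_block_def row_block_def intro!: eq_matI)
  ultimately show ?case unfolding step by simp
qed simp

lemma basic_symplectic_gram_schmidt_sr_factor:
  assumes B: "B \<in> carrier_mat (2 * n) (2 * k)" and f: "sr_factor n k B S R"
  shows "basic_symplectic_gram_schmidt n k B = Some (S, R)"
proof -
  have S: "S \<in> carrier_mat (2 * n) (2 * k)" and R: "R \<in> carrier_mat (2 * k) (2 * k)"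
    and ut: "upper_triangular R"
    using f by (auto simp: sr_factor_def T0_hat_def)
  let ?Ss = "map (col_block S) [0..<k]"
  let ?Rs = "map (\<lambda>c. map (row_block (col_block R c)) [0..<Suc c]) [0..<k]"
  have "bsgs_blocks n B k = Some (?Ss, ?Rs)"
    using bsgs_blocks_sr_factor[OF B] f first_cols_all[OF B] by simp
  moreover have "mat (2 * n) (2 * k) (\<lambda>(r, c). (?Ss ! (c div 2)) $$ (r, c mod 2)) = S"
  proof (rule eq_matI)
    fix r c assume "r < dim_row S" "c < dim_col S"
    then have "r < 2 * n" "c < 2 * k" "c div 2 < k" "2 * (c div 2) + c mod 2 = c" using S by auto
    then show "mat (2 * n) (2 * k) (\<lambda>(r, c). (?Ss ! (c div 2)) $$ (r, c mod 2)) $$ (r, c) = S $$ (r, c)"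
      using S by (simp add: col_block_def)
  qed (use S in auto)
  moreover have "mat (2 * k) (2 * k) (\<lambda>(r, c). if r div 2 \<le> c div 2
      then (?Rs ! (c div 2) ! (r div 2)) $$ (r mod 2, c mod 2) else 0) = R" (is "?M = R")
  proof (rule eq_matI)
    fix r c assume "r < dim_row R" "c < dim_col R"
    then have rc: "r < 2 * k" "c < 2 * k" "r div 2 < k" "c div 2 < k"
      "2 * (r div 2) + r mod 2 = r" "2 * (c div 2) + c mod 2 = c" using R by auto
    show "?M $$ (r, c) = R $$ (r, c)"
    proof (cases "r div 2 \<le> c div 2")
      case True
      then have "?Rs ! (c div 2) ! (r div 2) = row_block (col_block R (c div 2)) (r div 2)"
        using rc by (simp del: upt_Suc)
      then show ?thesis using True rc R by (simp add: col_block_def row_block_def del: upt_Suc)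
    next
      case False
      then have "c < r" by (meson div_le_mono not_le)
      then show ?thesis using False rc R ut by (simp add: upper_triangular_def)
    qed
  qed (use R in auto)
  ultimately show ?thesis by (simp add: basic_symplectic_gram_schmidt_def del: upt_Suc)
qed

section \<open>Undoing the column permutation\<close>

text \<open>
  The position of the nonzero entry in column \<open>c\<close> of \<open>P\<^bsub>2k\<^esub>\<close>.
\<close>

definition interleave :: "nat \<Rightarrow> nat \<Rightarrow> nat" where
  "interleave k c = (if c < k then 2 * c else 2 * (c - k) + 1)"

lemma interleave_less: "c < 2 * k \<Longrightarrow> interleave k c < 2 * k"
  by (auto simp: interleave_def)

lemma interleave_inject:
  "c < 2 * k \<Longrightarrow> d < 2 * k \<Longrightarrow> interleave k c = interleave k d \<longleftrightarrow> c = d"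
  unfolding interleave_def by (auto; presburger)

lemma P_mat_carrier [simp]: "P_mat k \<in> carrier_mat (2 * k) (2 * k)"
  by (rule carrier_matI) (simp_all add: P_mat_def)

lemma P_mat_dims [simp]: "dim_row (P_mat k) = 2 * k" "dim_col (P_mat k) = 2 * k"
  by (simp_all add: P_mat_def)

lemma P_mat_index:
  assumes "r < 2 * k" "c < 2 * k"
  shows "P_mat k $$ (r, c) = (if r = interleave k c then 1 else 0)"
  using assms by (auto simp: P_mat_def mat_of_cols_index nth_append interleave_def)

lemma mult_P_mat_index:
  assumes "X \<in> carrier_mat m (2 * k)" "r < m" "c < 2 * k"
  shows "(X * P_mat k) $$ (r, c) = X $$ (r, interleave k c)"
proof -
  have "(X * P_mat k) $$ (r, c) = (\<Sum>l = 0..<2 * k. X $$ (r, l) * P_mat k $$ (l, c))"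
    using assms by (auto simp: scalar_prod_def intro!: sum.cong)
  also have "\<dots> = (\<Sum>l = 0..<2 * k. if l = interleave k c then X $$ (r, l) else 0)"
    using assms by (intro sum.cong) (auto simp: P_mat_index)
  finally show ?thesis using interleave_less[OF assms(3)] by simp
qed

lemma P_mat_transpose_mult_index:
  assumes X: "X \<in> carrier_mat (2 * k) m" and "r < 2 * k" "c < m"
  shows "((P_mat k)\<^sup>T * X) $$ (r, c) = X $$ (interleave k r, c)"
proof -
  have "(P_mat k)\<^sup>T * X = (X\<^sup>T * P_mat k)\<^sup>T"
    using transpose_mult[of "X\<^sup>T" m "2 * k" "P_mat k" "2 * k"] X by simp
  then show ?thesis
    using mult_P_mat_index[of "X\<^sup>T" m k c r] assms interleave_less[of r k] by simp
qed

lemma P_mat_orthogonal: "(P_mat k)\<^sup>T * P_mat k = 1\<^sub>m (2 * k)"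
  using P_mat_transpose_mult_index[OF P_mat_carrier]
  by (intro eq_matI) (auto simp: P_mat_index interleave_less interleave_inject)

lemma P_mat_orthogonal': "P_mat k * (P_mat k)\<^sup>T = 1\<^sub>m (2 * k)"
  by (rule mat_mult_left_right_inverse[OF _ _ P_mat_orthogonal]) auto

lemma P_mat_conj_block_J: "(P_mat k)\<^sup>T * block_J k * P_mat k = J_mat k"
proof (rule eq_matI)
  have PB: "(P_mat k)\<^sup>T * block_J k \<in> carrier_mat (2 * k) (2 * k)"
    by (rule mult_carrier_mat[of _ _ "2 * k"]) auto
  fix r c assume "r < dim_row (J_mat k)" "c < dim_col (J_mat k)"
  then have rc: "r < 2 * k" "c < 2 * k" by auto
  have "((P_mat k)\<^sup>T * block_J k * P_mat k) $$ (r, c) = block_J k $$ (interleave k r, interleave k c)"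
    using mult_P_mat_index[OF PB rc] P_mat_transpose_mult_index[OF block_J_carrier, of r k "interleave k c"]
      rc interleave_less by simp
  also have "\<dots> = J_mat k $$ (r, c)"
    using rc interleave_less[of r k] interleave_less[of c k]
    by (auto simp: block_J_def J_mat_index interleave_def split: if_splits; presburger)
  finally show "((P_mat k)\<^sup>T * block_J k * P_mat k) $$ (r, c) = J_mat k $$ (r, c)" .
qed auto

lemma P_mat_cancel:
  assumes X: "X \<in> carrier_mat m (2 * k)"
  shows "X * P_mat k * (P_mat k)\<^sup>T = X" "X * (P_mat k)\<^sup>T * P_mat k = X"
  using assoc_mult_mat[OF X, of "P_mat k" "2 * k" "(P_mat k)\<^sup>T" "2 * k"]
    assoc_mult_mat[OF X, of "(P_mat k)\<^sup>T" "2 * k" "P_mat k" "2 * k"] X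
  by (simp_all add: P_mat_orthogonal P_mat_orthogonal')

lemma Sp_mult_P_mat_iff:
  assumes S: "S \<in> carrier_mat (2 * n) (2 * k)"
  shows "S * P_mat k \<in> Sp k n \<longleftrightarrow> symp_prod n S S = block_J k"
proof -
  have SP: "S * P_mat k \<in> carrier_mat (2 * n) (2 * k)" using S by auto
  have "(S * P_mat k)\<^sup>T * J_mat n * (S * P_mat k) = (P_mat k)\<^sup>T * symp_prod n S S * P_mat k"
    using symp_prod_mult[OF S S P_mat_carrier P_mat_carrier] by (simp add: symp_prod_def)
  moreover have "(P_mat k)\<^sup>T * X * P_mat k = (P_mat k)\<^sup>T * Y * P_mat k \<longleftrightarrow> X = Y"
    if X: "X \<in> carrier_mat (2 * k) (2 * k)" and Y: "Y \<in> carrier_mat (2 * k) (2 * k)" for X Y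
  proof
    have *: "P_mat k * ((P_mat k)\<^sup>T * Z * P_mat k * (P_mat k)\<^sup>T) = Z" if Z: "Z \<in> carrier_mat (2 * k) (2 * k)" for Z
    proof -
      have PZ: "(P_mat k)\<^sup>T * Z \<in> carrier_mat (2 * k) (2 * k)" using Z by auto
      show ?thesis unfolding P_mat_cancel(1)[OF PZ]
        using assoc_mult_mat[of "P_mat k" "2 * k" "2 * k" "(P_mat k)\<^sup>T" "2 * k" Z "2 * k"] Z
        by (simp add: P_mat_orthogonal')
    qed
    assume "(P_mat k)\<^sup>T * X * P_mat k = (P_mat k)\<^sup>T * Y * P_mat k"
    then have "P_mat k * ((P_mat k)\<^sup>T * X * P_mat k * (P_mat k)\<^sup>T) =
        P_mat k * ((P_mat k)\<^sup>T * Y * P_mat k * (P_mat k)\<^sup>T)" by (rule arg_cong)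
    then show "X = Y" unfolding *[OF X] *[OF Y] .
  qed simp
  ultimately show ?thesis
    using symp_prod_carrier[OF S S] SP by (simp add: Sp_def flip: P_mat_conj_block_J)
qed

lemma T0_iff: "R' \<in> T0 k \<longleftrightarrow> (\<exists>R \<in> T0_hat k. R' = (P_mat k)\<^sup>T * R * P_mat k)"
  by (auto simp: T0_def T0_hat_def)

lemma mult_P_mat_conj:
  assumes S: "S \<in> carrier_mat m (2 * k)" and R: "R \<in> carrier_mat (2 * k) (2 * k)"
  shows "S * P_mat k * ((P_mat k)\<^sup>T * R * P_mat k) = S * R * P_mat k"
proof -
  have PR: "(P_mat k)\<^sup>T * R \<in> carrier_mat (2 * k) (2 * k)" and SP: "S * P_mat k \<in> carrier_mat m (2 * k)"
    using S R by auto
  have "S * P_mat k * ((P_mat k)\<^sup>T * R * P_mat k) = S * P_mat k * ((P_mat k)\<^sup>T * R) * P_mat k"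
    by (rule assoc_mult_mat[OF SP PR P_mat_carrier, symmetric])
  also have "S * P_mat k * ((P_mat k)\<^sup>T * R) = S * P_mat k * (P_mat k)\<^sup>T * R"
    by (rule assoc_mult_mat[OF SP _ R, symmetric]) simp
  finally show ?thesis unfolding P_mat_cancel(1)[OF S] .
qed

text \<open>
  As \<open>P\<close> is orthogonal, \<open>A = (S P) (P\<^sup>T R P)\<close> is the same as \<open>A P\<^sup>T = S R\<close>, and \<open>S P\<close> is symplectic exactly
  when \<open>S\<^sup>T J S = P J P\<^sup>T\<close>.
\<close>

lemma sr_decomposition_iff_sr_factor:
  assumes A: "A \<in> carrier_mat (2 * n) (2 * k)"
  shows "A = S' * R' \<and> S' \<in> Sp k n \<and> R' \<in> T0 k \<longleftrightarrow>
    (\<exists>S R. sr_factor n k (A * (P_mat k)\<^sup>T) S R \<and> S' = S * P_mat k \<and> R' = (P_mat k)\<^sup>T * R * P_mat k)"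
proof
  assume h: "A = S' * R' \<and> S' \<in> Sp k n \<and> R' \<in> T0 k"
  then obtain R where R: "R \<in> T0_hat k" and R': "R' = (P_mat k)\<^sup>T * R * P_mat k" by (auto simp: T0_iff)
  note Rc = T0_hat_carrier[OF R]
  define S where "S = S' * (P_mat k)\<^sup>T"
  have S'c: "S' \<in> carrier_mat (2 * n) (2 * k)" using h by (simp add: Sp_def)
  then have S: "S \<in> carrier_mat (2 * n) (2 * k)" and S': "S' = S * P_mat k"
    by (auto simp: S_def P_mat_cancel(2)[OF S'c])
  have "S * R \<in> carrier_mat (2 * n) (2 * k)" using S Rc by auto
  then have "A * (P_mat k)\<^sup>T = S * R"
    using h mult_P_mat_conj[OF S Rc] P_mat_cancel(1) by (simp add: S' R')
  moreover have "symp_prod n S S = block_J k" using h S' Sp_mult_P_mat_iff[OF S] by simp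
  ultimately have "sr_factor n k (A * (P_mat k)\<^sup>T) S R" using S R by (simp add: sr_factor_def)
  then show "\<exists>S R. sr_factor n k (A * (P_mat k)\<^sup>T) S R \<and> S' = S * P_mat k \<and> R' = (P_mat k)\<^sup>T * R * P_mat k"
    using S' R' by blast
next
  assume "\<exists>S R. sr_factor n k (A * (P_mat k)\<^sup>T) S R \<and> S' = S * P_mat k \<and> R' = (P_mat k)\<^sup>T * R * P_mat k"
  then obtain S R where S: "S \<in> carrier_mat (2 * n) (2 * k)" and SS: "symp_prod n S S = block_J k"
    and R: "R \<in> T0_hat k" and AP: "A * (P_mat k)\<^sup>T = S * R"
    and S': "S' = S * P_mat k" and R': "R' = (P_mat k)\<^sup>T * R * P_mat k"
    by (auto simp: sr_factor_def)
  have "S' * R' = A"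
    unfolding S' R' mult_P_mat_conj[OF S T0_hat_carrier[OF R]] AP[symmetric] by (rule P_mat_cancel(2)[OF A])
  then show "A = S' * R' \<and> S' \<in> Sp k n \<and> R' \<in> T0 k"
    using Sp_mult_P_mat_iff[OF S] SS R S' R' by (auto simp: T0_iff)
qed

theorem proposition3p5:
  fixes n k :: nat and A :: "real mat"
  assumes "1 \<le> k" and "k \<le> n"
    and "A \<in> carrier_mat (2 * n) (2 * k)"
    and "\<And>j. 1 \<le> j \<Longrightarrow> j \<le> k \<Longrightarrow>
      det (leading_principal (P_mat k * A\<^sup>T * J_mat n * A * (P_mat k)\<^sup>T) (2 * j)) \<noteq> 0"
  shows "\<exists>S R. symplectic_gram_schmidt n k A = Some (S, R) \<and>
      (A = S * R \<and> S \<in> Sp k n \<and> R \<in> T0 k) \<and>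
      (\<forall>S' R'. A = S' * R' \<and> S' \<in> Sp k n \<and> R' \<in> T0 k \<longrightarrow> S' = S \<and> R' = R)"
proof -
  note A = assms(3)
  define B where "B = A * (P_mat k)\<^sup>T"
  have B: "B \<in> carrier_mat (2 * n) (2 * k)" using A by (auto simp: B_def)
  have "symp_prod n B B = P_mat k * symp_prod n A A * (P_mat k)\<^sup>T"
    unfolding B_def using symp_prod_mult[OF A A, of "(P_mat k)\<^sup>T" "2 * k" "(P_mat k)\<^sup>T" "2 * k"] by simp
  also have "P_mat k * symp_prod n A A = P_mat k * (A\<^sup>T * J_mat n) * A"
    unfolding symp_prod_def by (rule assoc_mult_mat[symmetric, of _ _ "2 * k" _ "2 * n"]) (use A in auto)
  also have "P_mat k * (A\<^sup>T * J_mat n) = P_mat k * A\<^sup>T * J_mat n"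
    by (rule assoc_mult_mat[symmetric, of _ _ "2 * k" _ "2 * n"]) (use A in auto)
  finally have gram: "symp_prod n B B = P_mat k * A\<^sup>T * J_mat n * A * (P_mat k)\<^sup>T" .
  obtain S R where f: "sr_factor n k B S R"
    using sr_factor_exists[OF B, of k] assms(4) first_cols_all[OF B] by (auto simp: gram)
  have unique: "S\<^sub>1 = S \<and> R\<^sub>1 = R" if "sr_factor n k B S\<^sub>1 R\<^sub>1" for S\<^sub>1 R\<^sub>1
    using basic_symplectic_gram_schmidt_sr_factor[OF B f] basic_symplectic_gram_schmidt_sr_factor[OF B that] by simp
  have run: "symplectic_gram_schmidt n k A = Some (S * P_mat k, (P_mat k)\<^sup>T * R * P_mat k)"
    using basic_symplectic_gram_schmidt_sr_factor[OF B f] by (simp add: symplectic_gram_schmidt_def B_def)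
  show ?thesis
    using run f unique unfolding sr_decomposition_iff_sr_factor[OF A] B_def[symmetric] by blast
qed

end
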